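(* Let $\mathcal{M}_W=(S,P,W)$ be a WDTMC with initialization point $s_{\mathrm{init}}$. Then $\mathcal{M}_W$ is absolutely convergent if and only if both of the following hold: (1) there does not exist an edge $e$ reachable from $s_{\mathrm{init}}$ such that $W(e)=\infty$; (2) for any simple cycle $\mathcal{C}$ reachable from $s_{\mathrm{init}}$, $W(\mathcal{C})<0$.
   Context: A DTMC is a pair $(S,P)$ where $S$ is a set of states and $P$ assigns to each $s\in S$ a probability distribution on $S$; write $P(s,s')=P(s)(s')$. A path is a (finite or infinite) sequence of states $\sigma=\sigma_1,\sigma_2,\dots$ with $P(\sigma_i,\sigma_{i+1})>0$ for all consecutive states; an edge is a path of length $2$, i.e. a pair $(s,s')$ with $P(s,s')>0$. A weighted DTMC (WDTMC) is a triple $(S,P,W)$ where $(S,P)$ is a DTMC and $W$ is a weight function on the edges, with values in $\mathbb{R}\cup\{+\infty\}$. The weight of a finite path is the sum of $W(\sigma_i,\sigma_{i+1})$ over its consecutive pairs; for an infinite path $W(\sigma)=\lim_{n\to\infty}\sum_{i=1}^n W(\sigma_i,\sigma_{i+1})$. A simple cycle is a path in which only the starting and the ending states are the same. An edge or cycle is reachable from $s_{\mathrm{init}}$ if some finite path starting at $s_{\mathrm{init}}$ ends with it. All paths considered start from a single state $s_{\mathrm{init}}$, called the initialization point: $\mathcal{M}_W$ is absolutely convergent if every infinite path $\sigma$ with $\sigma_1=s_{\mathrm{init}}$ has weight diverging to $-\infty$, i.e. $W(\sigma)=-\infty$.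
   Formalization: The state set S is assumed finite; for infinite S the claim fails (e.g. S = ℕ, each n moving to n+1 with weight 0: no cycles and no infinite edges, yet the only infinite path has weight 0). *)

theory Defs
  imports "HOL-Probability.Probability_Mass_Function" "HOL-Library.Extended_Real" "HOL-Library.Sublist"
begin

definition is_dtmc :: "'s set \<Rightarrow> ('s \<Rightarrow> 's pmf) \<Rightarrow> bool" where
  "is_dtmc S P \<longleftrightarrow> (\<forall>s\<in>S. set_pmf (P s) \<subseteq> S)"

definition edge :: "'s set \<Rightarrow> ('s \<Rightarrow> 's pmf) \<Rightarrow> 's \<Rightarrow> 's \<Rightarrow> bool" where
  "edge S P s s' \<longleftrightarrow> s \<in> S \<and> s' \<in> S \<and> pmf (P s) s' > 0"

text \<open>The weight function is total on pairs of states, but its values off the edges are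
  unconstrained and never used. On edges the value \<open>-\<infinity>\<close> is excluded, so no sum of
  weights below mixes \<open>\<infinity>\<close> and \<open>-\<infinity>\<close>.\<close>

definition is_wdtmc :: "'s set \<Rightarrow> ('s \<Rightarrow> 's pmf) \<Rightarrow> ('s \<times> 's \<Rightarrow> ereal) \<Rightarrow> bool" where
  "is_wdtmc S P W \<longleftrightarrow> is_dtmc S P \<and> (\<forall>s s'. edge S P s s' \<longrightarrow> W (s, s') \<noteq> -\<infinity>)"

definition finite_path :: "'s set \<Rightarrow> ('s \<Rightarrow> 's pmf) \<Rightarrow> 's list \<Rightarrow> bool" where
  "finite_path S P p \<longleftrightarrow>
     p \<noteq> [] \<and> set p \<subseteq> S \<and> (\<forall>i. Suc i < length p \<longrightarrow> edge S P (p ! i) (p ! Suc i))"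

definition infinite_path :: "'s set \<Rightarrow> ('s \<Rightarrow> 's pmf) \<Rightarrow> (nat \<Rightarrow> 's) \<Rightarrow> bool" where
  "infinite_path S P \<sigma> \<longleftrightarrow> (\<forall>i. edge S P (\<sigma> i) (\<sigma> (Suc i)))"

definition path_weight :: "('s \<times> 's \<Rightarrow> ereal) \<Rightarrow> 's list \<Rightarrow> ereal" where
  "path_weight W p = (\<Sum>i<length p - 1. W (p ! i, p ! Suc i))"

text \<open>The weight of an infinite path need not exist, so it is a relation: \<open>w\<close> is the
  limit in the extended reals of the partial sums. Infinite paths are indexed from \<open>0\<close>.\<close>

definition has_path_weight ::
  "('s \<times> 's \<Rightarrow> ereal) \<Rightarrow> (nat \<Rightarrow> 's) \<Rightarrow> ereal \<Rightarrow> bool" where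
  "has_path_weight W \<sigma> w \<longleftrightarrow> (\<lambda>n. \<Sum>i<n. W (\<sigma> i, \<sigma> (Suc i))) \<longlonglongrightarrow> w"

text \<open>The start is repeated as last entry, so a self-loop at \<open>s\<close> is \<open>[s, s]\<close>; the
  one-state path \<open>[s]\<close>, which has no edge, is not a cycle.\<close>

definition simple_cycle :: "'s set \<Rightarrow> ('s \<Rightarrow> 's pmf) \<Rightarrow> 's list \<Rightarrow> bool" where
  "simple_cycle S P c \<longleftrightarrow>
     finite_path S P c \<and> length c \<ge> 2 \<and> hd c = last c \<and> distinct (butlast c)"

text \<open>\<open>q\<close> is an edge \<open>[s, s']\<close> or a cycle.\<close>

definition reachable_from :: "'s set \<Rightarrow> ('s \<Rightarrow> 's pmf) \<Rightarrow> 's \<Rightarrow> 's list \<Rightarrow> bool" where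
  "reachable_from S P s\<^sub>0 q \<longleftrightarrow> (\<exists>p. finite_path S P p \<and> hd p = s\<^sub>0 \<and> suffix q p)"

definition absolutely_convergent ::
  "'s set \<Rightarrow> ('s \<Rightarrow> 's pmf) \<Rightarrow> ('s \<times> 's \<Rightarrow> ereal) \<Rightarrow> 's \<Rightarrow> bool" where
  "absolutely_convergent S P W s\<^sub>0 \<longleftrightarrow>
     (\<forall>\<sigma>. infinite_path S P \<sigma> \<and> \<sigma> 0 = s\<^sub>0 \<longrightarrow> has_path_weight W \<sigma> (-\<infinity>))"

end

theory Submission
  imports Defs
begin

text \<open>If all reachable edges have finite weight and all reachable simple cycles are negative, then
  finiteness of the state space gives constants \<open>b\<close> and \<open>e > 0\<close> such that distinct paths from the
  initial state weigh at most \<open>b\<close> and simple cycles at most \<open>-e\<close> per edge. Excising simple cycles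
  one at a time bounds the weight of every path with \<open>n\<close> edges by \<open>b - e * n\<close>. Conversely, a
  reachable edge of weight \<open>\<infinity>\<close> makes all later partial sums infinite, and running around a
  nonnegative cycle forever keeps infinitely many partial sums above a fixed number.\<close>

section \<open>Splitting paths, weights and uniform bounds\<close>

lemma finite_path_iff_successively:
  "finite_path S P p \<longleftrightarrow> p \<noteq> [] \<and> set p \<subseteq> S \<and> successively (edge S P) p"
  by (auto simp: finite_path_def successively_conv_nth)

lemma finite_path_append_iff:
  "finite_path S P (xs @ x # ys) \<longleftrightarrow> finite_path S P (xs @ [x]) \<and> finite_path S P (x # ys)"
  by (auto simp: finite_path_iff_successively successively_append_iff)

lemma path_weight_Cons_Cons:
  "path_weight W (x # y # zs) = W (x, y) + path_weight W (y # zs)"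
  by (simp add: path_weight_def sum.lessThan_Suc_shift del: sum.lessThan_Suc)

text \<open>The two pieces share \<open>x\<close>, so every edge of the whole list lies in exactly
  one of them.\<close>

lemma path_weight_append:
  "path_weight W (xs @ x # ys) = path_weight W (xs @ [x]) + path_weight W (x # ys)"
proof (induction xs)
  case Nil
  show ?case by (simp add: path_weight_def)
next
  case (Cons a xs)
  then show ?case
    by (cases xs) (simp_all add: path_weight_Cons_Cons add.assoc path_weight_def[of W "[_]"])
qed

text \<open>In the shortest prefix with a repetition, the last entry is the only one that repeats an
  earlier one. In a path, the segment between the two occurrences is then a simple cycle.\<close>

lemma not_distinct_first_repetition:
  assumes "\<not> distinct ws"
  obtains xs y ys zs where "ws = xs @ y # ys @ y # zs" "distinct (y # ys)"
proof -
  from assms have "\<exists>xs y ys zs. ws = xs @ y # ys @ y # zs \<and> distinct (y # ys)"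
  proof (induction ws rule: rev_induct)
    case (snoc z vs)
    show ?case
    proof (cases "distinct vs")
      case True
      with snoc.prems have "z \<in> set vs" by simp
      then obtain xs ys where "vs = xs @ z # ys" by (meson split_list)
      with True show ?thesis by fastforce
    next
      case False
      with snoc.IH show ?thesis by fastforce
    qed
  qed simp
  with that show thesis by blast
qed

text \<open>The maximum of finitely many values stays strictly below \<open>u\<close>, and density
  gives a real between them. It serves cycles with \<open>u = 0\<close> and distinct paths with
  \<open>u = \<infinity>\<close>.\<close>

lemma finite_uniform_ereal_bound:
  fixes f :: "'b \<Rightarrow> ereal"
  assumes "finite F" "\<And>x. x \<in> F \<Longrightarrow> f x < u" "-\<infinity> < u"
  obtains r where "ereal r < u" "\<And>x. x \<in> F \<Longrightarrow> f x \<le> ereal r"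
proof -
  \<comment> \<open>The extra element keeps the maximum meaningful when \<open>F\<close> is
    empty.\<close>
  let ?M = "insert (-\<infinity>) (f ` F)"
  have "Max ?M < u" using assms by (subst Max_less_iff) auto
  then obtain r where "Max ?M < ereal r" "ereal r < u" using ereal_dense2 by blast
  moreover from this assms(1) have "f x \<le> ereal r" if "x \<in> F" for x
    using that by (subst (asm) Max_less_iff) (auto intro: less_imp_le)
  ultimately show thesis using that by blast
qed

lemma sum_lessThan_add:
  fixes f :: "nat \<Rightarrow> 'b::comm_monoid_add"
  shows "(\<Sum>i<m + n. f i) = (\<Sum>i<m. f i) + (\<Sum>i<n. f (m + i))"
  by (induction n) (simp_all add: add.assoc)

lemma ereal_sum_not_MInfty:
  fixes f :: "'b \<Rightarrow> ereal"
  assumes "\<And>i. i \<in> A \<Longrightarrow> f i \<noteq> -\<infinity>"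
  shows "sum f A \<noteq> -\<infinity>"
  using assms by (induction A rule: infinite_finite_induct) auto

section \<open>A linear upper bound on path weights\<close>

text \<open>The bound is linear in the number of edges because edge counts and weights both add up
  when a cycle is split off, so it survives the excision.\<close>

lemma finite_path_linear_bound:
  assumes fin: "finite S"
    and edges: "\<And>s s'. edge S P s s' \<Longrightarrow> reachable_from S P s\<^sub>0 [s, s'] \<Longrightarrow> W (s, s') \<noteq> \<infinity>"
    and cycles: "\<And>c. simple_cycle S P c \<Longrightarrow> reachable_from S P s\<^sub>0 c \<Longrightarrow> path_weight W c < 0"
  shows "\<exists>(e::real) (b::real). e > 0 \<and>
    (\<forall>p. finite_path S P p \<and> hd p = s\<^sub>0 \<longrightarrow> path_weight W p \<le> ereal (b - e * (length p - 1)))"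
proof -
  \<comment> \<open>A distinct path has at most \<open>card S\<close> entries; a simple cycle
    repeats its start and may have one more.\<close>
  define N where "N = Suc (card S)"
  have short: "finite {p. set p \<subseteq> S \<and> length p \<le> N}"
    using fin by (rule finite_lists_length_le)
  have distinct_length: "length p \<le> card S" if "distinct p" "set p \<subseteq> S" for p
    using that fin by (metis card_mono distinct_card)

  let ?C = "{c. simple_cycle S P c \<and> reachable_from S P s\<^sub>0 c}"
  have cycle_length: "set c \<subseteq> S \<and> length c \<le> N" if "simple_cycle S P c" for c
    using that distinct_length[of "butlast c"]
    by (fastforce simp: simple_cycle_def finite_path_def N_def dest: in_set_butlastD)
  then have "finite ?C" by (intro finite_subset[OF _ short]) auto
  then obtain r where r: "ereal r < 0" "\<And>c. c \<in> ?C \<Longrightarrow> path_weight W c \<le> ereal r"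
    by (rule finite_uniform_ereal_bound[of ?C "path_weight W" 0]) (use cycles in auto)
  \<comment> \<open>The total \<open>r\<close> of a cycle is spread over its edges, of which there
    are at most \<open>N\<close>.\<close>
  define e where "e = - r / N"
  have "e > 0" using r(1) by (simp add: e_def N_def divide_neg_pos)
  have cycle_bound: "path_weight W c \<le> ereal (- e * (length c - 1))" if "c \<in> ?C" for c
  proof -
    have "e * (length c - 1) \<le> e * N"
      using \<open>e > 0\<close> cycle_length[of c] that by (intro mult_left_mono) auto
    also have "\<dots> = - r" by (simp add: e_def N_def)
    finally have "r \<le> - e * (length c - 1)" by simp
    with r(2)[OF that] show ?thesis by (meson ereal_less_eq(3) order_trans)
  qed

  let ?D = "{p. finite_path S P p \<and> hd p = s\<^sub>0 \<and> distinct p}"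
  \<comment> \<open>A sum is \<infinity> only if some term is, and each edge of \<open>p\<close> is
    reachable along the part of \<open>p\<close> that ends with it.\<close>
  have "path_weight W p < \<infinity>" if p: "finite_path S P p" "hd p = s\<^sub>0" for p
  proof -
    have "W (p ! i, p ! Suc i) \<noteq> \<infinity>" if i: "i < length p - 1" for i
    proof (rule edges)
      show "edge S P (p ! i) (p ! Suc i)" using p i by (simp add: finite_path_def)
      have "p = take i p @ p ! i # p ! Suc i # drop (Suc (Suc i)) p"
        using i id_take_nth_drop[of i p] Cons_nth_drop_Suc[of "Suc i" p] by simp
      then obtain xs zs where split: "p = (xs @ [p ! i]) @ p ! Suc i # zs"
        by (metis append.assoc append_Cons append_Nil)
      then have "finite_path S P ((xs @ [p ! i]) @ [p ! Suc i])"
        using p(1) finite_path_append_iff by metis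
      moreover have "hd ((xs @ [p ! i]) @ [p ! Suc i]) = hd p"
        using arg_cong[OF split, of hd] by (simp add: hd_append)
      ultimately show "reachable_from S P s\<^sub>0 [p ! i, p ! Suc i]"
        unfolding reachable_from_def suffix_def using p(2) by fastforce
    qed
    then show ?thesis unfolding path_weight_def
      by (auto simp: less_top[symmetric] sum_Pinfty)
  qed
  moreover have "finite ?D"
    using distinct_length
    by (intro finite_subset[OF _ short]) (force simp: N_def finite_path_def le_Suc_eq)
  ultimately obtain b\<^sub>0 where b\<^sub>0: "\<And>p. p \<in> ?D \<Longrightarrow> path_weight W p \<le> ereal b\<^sub>0"
    by (elim finite_uniform_ereal_bound[of ?D "path_weight W" \<infinity>]) auto
  \<comment> \<open>The surplus \<open>e * N\<close> pays for the at most \<open>N\<close> edges of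
    a distinct path.\<close>
  define b where "b = b\<^sub>0 + e * N"

  have "path_weight W p \<le> ereal (b - e * (length p - 1))"
    if "finite_path S P p" "hd p = s\<^sub>0" for p
    using that
  proof (induction p rule: length_induct)
    case (1 p)
    show ?case
    proof (cases "distinct p")
      case True
      have "e * (length p - 1) \<le> e * N"
        using distinct_length[OF True] 1(2) \<open>e > 0\<close>
        by (intro mult_left_mono) (auto simp: N_def finite_path_def)
      then have "b\<^sub>0 \<le> b - e * (length p - 1)" by (simp add: b_def)
      moreover have "path_weight W p \<le> ereal b\<^sub>0" using b\<^sub>0 True 1 by simp
      ultimately show ?thesis by (meson ereal_less_eq(3) order_trans)
    next
      case False
      then obtain xs y ys zs where p: "p = xs @ y # ys @ y # zs" and "distinct (y # ys)"
        by (rule not_distinct_first_repetition)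
      let ?c = "y # ys @ [y]" and ?q = "xs @ y # zs"
      have paths: "finite_path S P (xs @ [y])" "finite_path S P ?c" "finite_path S P (y # zs)"
        using 1(2) finite_path_append_iff[of S P xs y "ys @ y # zs"]
          finite_path_append_iff[of S P "y # ys" y zs]
        by (simp_all add: p)
      \<comment> \<open>Cutting \<open>p\<close> after the second \<open>y\<close> leaves a path
        that ends with the cycle, which is therefore reachable.\<close>
      have "finite_path S P (xs @ ?c)" "hd (xs @ ?c) = s\<^sub>0"
        using paths finite_path_append_iff[of S P xs y "ys @ [y]"] 1(3)
        by (auto simp: p hd_append)
      then have "reachable_from S P s\<^sub>0 ?c" by (auto simp: reachable_from_def suffix_def)
      moreover have "simple_cycle S P ?c"
        using paths(2) \<open>distinct (y # ys)\<close> by (simp add: simple_cycle_def butlast_append)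
      ultimately have c: "path_weight W ?c \<le> ereal (- e * (length ?c - 1))"
        by (intro cycle_bound) simp
      have "finite_path S P ?q" "hd ?q = s\<^sub>0" "length ?q < length p"
        using paths finite_path_append_iff[of S P xs y zs] 1(3) by (auto simp: p hd_append)
      then have q: "path_weight W ?q \<le> ereal (b - e * (length ?q - 1))" using 1(1) by blast
      \<comment> \<open>Both occurrences of \<open>y\<close> are cut points; the two outer pieces
        join to form \<open>?q\<close>.\<close>
      have "path_weight W p = path_weight W ?q + path_weight W ?c"
        using path_weight_append[of W xs y "ys @ y # zs"] path_weight_append[of W "y # ys" y zs]
          path_weight_append[of W xs y zs]
        by (simp add: p ac_simps)
      also have "\<dots> \<le> ereal (b - e * (length ?q - 1)) + ereal (- e * (length ?c - 1))"
        using q c by (rule add_mono)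
      also have "\<dots> = ereal (b - e * (length p - 1))"
        by (simp add: p algebra_simps)
      finally show ?thesis .
    qed
  qed
  with \<open>e > 0\<close> show ?thesis by blast
qed

section \<open>Finite prefixes and infinite extensions\<close>

lemma finite_path_prefix:
  assumes "infinite_path S P \<sigma>"
  shows "finite_path S P (map \<sigma> [0..<Suc n])"
  using assms by (fastforce simp: finite_path_def infinite_path_def edge_def nth_append
      simp del: upt_Suc)

text \<open>\<open>Suc n\<close> states span \<open>n\<close> edges, which matches the partial sum
  with \<open>n\<close> terms.\<close>

lemma path_weight_prefix:
  "path_weight W (map \<sigma> [0..<Suc n]) = (\<Sum>i<n. W (\<sigma> i, \<sigma> (Suc i)))"
  by (simp add: path_weight_def del: upt_Suc)

text \<open>Every state has a successor, since a distribution has nonempty support; iterating a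
  chosen successor prolongs the path. This turns reachability, a finite notion, into an infinite
  path to which convergence applies.\<close>

lemma finite_path_extend:
  assumes "is_dtmc S P" "finite_path S P p"
  obtains \<sigma> where "infinite_path S P \<sigma>" "\<And>i. i < length p \<Longrightarrow> \<sigma> i = p ! i"
proof -
  have "\<exists>s'. edge S P s s'" if "s \<in> S" for s
    using assms(1) that set_pmf_not_empty[of "P s"]
    by (fastforce simp: is_dtmc_def edge_def pmf_positive_iff)
  then obtain nxt where nxt: "\<And>s. s \<in> S \<Longrightarrow> edge S P s (nxt s)" by metis
  define k where "k = length p - 1"
  have len: "length p = Suc k" using assms(2) by (simp add: k_def finite_path_def)
  \<comment> \<open>The branches agree at \<open>i = k\<close>, so the edge leaving the last entry
    of \<open>p\<close> is already a step of \<open>nxt\<close>.\<close>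
  define \<sigma> where "\<sigma> i = (if i \<le> k then p ! i else (nxt ^^ (i - k)) (p ! k))" for i
  have tail: "(nxt ^^ j) (p ! k) \<in> S" for j
  proof (induction j)
    case 0
    show ?case using assms(2) len by (auto simp: finite_path_def)
  next
    case (Suc j)
    from nxt[OF this] show ?case by (simp add: edge_def)
  qed
  have "edge S P (\<sigma> i) (\<sigma> (Suc i))" for i
  proof (cases "i < k")
    case True
    then show ?thesis using assms(2) len by (simp add: \<sigma>_def finite_path_def)
  next
    case False
    then show ?thesis using nxt[OF tail[of "i - k"]] by (auto simp: \<sigma>_def Suc_diff_le)
  qed
  with that[of \<sigma>] len show thesis by (simp add: infinite_path_def \<sigma>_def)
qed

section \<open>Necessity of the two conditions\<close>

lemma absolutely_convergent_edge_finite: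
  assumes "is_dtmc S P" "absolutely_convergent S P W s\<^sub>0" "reachable_from S P s\<^sub>0 [s, s']"
  shows "W (s, s') \<noteq> \<infinity>"
proof
  assume inf: "W (s, s') = \<infinity>"
  obtain zs where p: "finite_path S P (zs @ [s, s'])" "hd (zs @ [s, s']) = s\<^sub>0"
    using assms(3) by (auto simp: reachable_from_def suffix_def)
  obtain \<sigma> where \<sigma>: "infinite_path S P \<sigma>"
    "\<And>i. i < length (zs @ [s, s']) \<Longrightarrow> \<sigma> i = (zs @ [s, s']) ! i"
    using finite_path_extend[OF assms(1) p(1)] by blast
  have "\<sigma> 0 = s\<^sub>0" using p(2) \<sigma>(2)[of 0] by (simp add: hd_conv_nth)
  with assms(2) \<sigma>(1) have "(\<lambda>n. \<Sum>i<n. W (\<sigma> i, \<sigma> (Suc i))) \<longlonglongrightarrow> -\<infinity>"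
    by (simp add: absolutely_convergent_def has_path_weight_def)
  moreover have "W (\<sigma> (length zs), \<sigma> (Suc (length zs))) = \<infinity>"
    using inf by (simp add: \<sigma>(2) nth_append)
  then have "eventually (\<lambda>n. (\<Sum>i<n. W (\<sigma> i, \<sigma> (Suc i))) = \<infinity>) sequentially"
    \<comment> \<open>In \<open>ereal\<close> a finite sum with a term \<infinity> equals
      \<infinity>, whatever its other terms are.\<close>
    by (intro eventually_sequentiallyI[of "Suc (length zs)"]) (auto simp: sum_Pinfty Suc_le_eq)
  then have "(\<lambda>n. \<Sum>i<n. W (\<sigma> i, \<sigma> (Suc i))) \<longlonglongrightarrow> \<infinity>"
    by (rule tendsto_eventually)
  ultimately show False using LIMSEQ_unique by fastforce
qed

text \<open>Sampled once per round of a nonnegative cycle, the partial sums never decrease, so they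
  cannot tend to \<open>-\<infinity>\<close>.\<close>

lemma absolutely_convergent_cycle_negative:
  assumes wdtmc: "is_wdtmc S P W" and conv: "absolutely_convergent S P W s\<^sub>0"
    and c: "simple_cycle S P c" "reachable_from S P s\<^sub>0 c"
  shows "path_weight W c < 0"
proof (rule ccontr)
  assume "\<not> path_weight W c < 0"
  then have nonneg: "0 \<le> path_weight W c" by simp
  obtain zs where p: "finite_path S P (zs @ c)" "hd (zs @ c) = s\<^sub>0"
    using c(2) by (auto simp: reachable_from_def suffix_def)
  \<comment> \<open>The cycle is entered at index \<open>k\<close> and has \<open>L\<close> edges;
    its repeated last entry is not counted.\<close>
  define k L where "k = length zs" and "L = length c - 1"
  have len: "length c = Suc L" and "L > 0" and closed: "c ! L = c ! 0"
    using c(1) hd_conv_nth[of c] last_conv_nth[of c]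
    by (auto simp: L_def simple_cycle_def finite_path_def)
  define \<sigma> where "\<sigma> i = (if i < k then zs ! i else c ! ((i - k) mod L))" for i
  have on_path: "\<sigma> i = (zs @ c) ! i" if "i \<le> k + L" for i
    using that closed \<open>L > 0\<close>
    by (cases "i = k + L") (auto simp: \<sigma>_def nth_append k_def)
  \<comment> \<open>Admitting \<open>i = L\<close>, by \<open>closed\<close>, lets the closing edge
    be treated like the others.\<close>
  have on_cycle: "\<sigma> (k + m * L + i) = c ! i" if "i \<le> L" for m i
    using that closed \<open>L > 0\<close> by (cases "i = L") (auto simp: \<sigma>_def)
  have "edge S P (\<sigma> i) (\<sigma> (Suc i))" for i
  proof (cases "i < k")
    case True
    then show ?thesis
      using p(1) len by (simp add: on_path finite_path_def k_def)
  next
    case False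
    define m j where "m = (i - k) div L" and "j = (i - k) mod L"
    have i: "i = k + m * L + j" and "j < L"
      using False \<open>L > 0\<close> by (simp_all add: m_def j_def)
    then have "\<sigma> i = c ! j" "\<sigma> (Suc i) = c ! Suc j"
      using on_cycle[of j m] on_cycle[of "Suc j" m] by simp_all
    then show ?thesis
      using c(1) \<open>j < L\<close> len by (simp add: simple_cycle_def finite_path_def)
  qed
  then have path: "infinite_path S P \<sigma>" by (simp add: infinite_path_def)
  define T where "T n = (\<Sum>i<n. W (\<sigma> i, \<sigma> (Suc i)))" for n
  have "\<sigma> 0 = s\<^sub>0"
    using on_path[of 0] p(2) len hd_conv_nth[of "zs @ c"] by fastforce
  with conv path have "T \<longlonglongrightarrow> -\<infinity>"
    by (simp add: absolutely_convergent_def has_path_weight_def T_def[abs_def])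
  have "(\<Sum>i<L. W (\<sigma> (k + m * L + i), \<sigma> (Suc (k + m * L + i)))) = path_weight W c" for m
    unfolding path_weight_def L_def[symmetric]
    using on_cycle[of _ m] on_cycle[of "Suc _" m] by (intro sum.cong) simp_all
  then have "T (k + m * L + L) = T (k + m * L) + path_weight W c" for m
    by (simp add: T_def sum_lessThan_add[of _ "k + m * L" L])
  moreover have "x \<le> x + path_weight W c" for x
    using add_left_mono[OF nonneg, of x] by simp
  ultimately have step: "T (k + m * L) \<le> T (k + Suc m * L)" for m
    by (metis add.assoc add.commute mult_Suc)
  have above: "T k \<le> T (k + m * L)" for m
    by (induction m) (simp, use step order_trans in blast)
  \<comment> \<open>The lower bound \<open>T k\<close> is informative only because no edge weighs
    \<open>-\<infinity>\<close>.\<close>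
  have "T k \<noteq> -\<infinity>"
    unfolding T_def using wdtmc path
    by (intro ereal_sum_not_MInfty) (simp add: is_wdtmc_def infinite_path_def)
  then obtain r where "ereal r < T k" using ereal_dense2[of "-\<infinity>" "T k"] by auto
  moreover obtain M where "\<And>n. n \<ge> M \<Longrightarrow> T n < ereal r"
    using \<open>T \<longlonglongrightarrow> -\<infinity>\<close> by (auto simp: tendsto_MInfty eventually_sequentially)
  then have "T (k + M * L) < ereal r" using \<open>L > 0\<close> by (simp add: trans_le_add2)
  ultimately show False using above[of M] by simp
qed

section \<open>Sufficiency and the equivalence\<close>

lemma absolutely_convergentI:
  assumes "finite S"
    and "\<And>s s'. edge S P s s' \<Longrightarrow> reachable_from S P s\<^sub>0 [s, s'] \<Longrightarrow> W (s, s') \<noteq> \<infinity>"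
    and "\<And>c. simple_cycle S P c \<Longrightarrow> reachable_from S P s\<^sub>0 c \<Longrightarrow> path_weight W c < 0"
  shows "absolutely_convergent S P W s\<^sub>0"
  unfolding absolutely_convergent_def has_path_weight_def tendsto_MInfty
proof (intro allI impI)
  fix \<sigma> r
  assume \<sigma>: "infinite_path S P \<sigma> \<and> \<sigma> 0 = s\<^sub>0"
  have "\<exists>(e::real) (b::real). e > 0 \<and>
    (\<forall>p. finite_path S P p \<and> hd p = s\<^sub>0 \<longrightarrow> path_weight W p \<le> ereal (b - e * (length p - 1)))"
    by (rule finite_path_linear_bound) (fact assms)+
  then obtain e b :: real where e: "e > 0" and bound:
    "\<forall>p. finite_path S P p \<and> hd p = s\<^sub>0 \<longrightarrow> path_weight W p \<le> ereal (b - e * (length p - 1))"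
    by (elim exE conjE)
  have T: "(\<Sum>i<n. W (\<sigma> i, \<sigma> (Suc i))) \<le> ereal (b - e * n)" for n
    using bound[rule_format, of "map \<sigma> [0..<Suc n]"] finite_path_prefix[of S P \<sigma> n] \<sigma>
    by (simp add: path_weight_prefix hd_conv_nth del: upt_Suc)
  \<comment> \<open>The line \<open>b - e * n\<close> drops below \<open>r\<close> once
    \<open>n\<close> exceeds \<open>(b - r) / e\<close>.\<close>
  obtain M :: nat where M: "(b - r) / e < M" using reals_Archimedean2 by blast
  show "eventually (\<lambda>n. (\<Sum>i<n. W (\<sigma> i, \<sigma> (Suc i))) < ereal r) sequentially"
  proof (rule eventually_sequentiallyI)
    fix n assume "M \<le> n"
    with M have "(b - r) / e < n" by linarith
    with e have "b - e * n < r" by (simp add: field_simps)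
    with T[of n] show "(\<Sum>i<n. W (\<sigma> i, \<sigma> (Suc i))) < ereal r"
      by (meson ereal_less(1) le_less_trans less_ereal.simps(1))
  qed
qed

text \<open>Finiteness of \<open>S\<close> matters for sufficiency: on an infinite chain that never
  revisits a state, with all weights 0, both conditions hold but the weight is 0.\<close>

theorem theorem2:
  fixes S :: "'s set" and P :: "'s \<Rightarrow> 's pmf" and W :: "'s \<times> 's \<Rightarrow> ereal" and s_init :: 's
  assumes "is_wdtmc S P W"
    and "finite S"
    and "s_init \<in> S"
  shows "absolutely_convergent S P W s_init \<longleftrightarrow>
    (\<not> (\<exists>s s'. edge S P s s' \<and> reachable_from S P s_init [s, s'] \<and> W (s, s') = \<infinity>)) \<and>
    (\<forall>c. simple_cycle S P c \<and> reachable_from S P s_init c \<longrightarrow> path_weight W c < 0)"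
proof
  assume "absolutely_convergent S P W s_init"
  with assms(1) show "(\<not> (\<exists>s s'. edge S P s s' \<and> reachable_from S P s_init [s, s'] \<and> W (s, s') = \<infinity>)) \<and>
    (\<forall>c. simple_cycle S P c \<and> reachable_from S P s_init c \<longrightarrow> path_weight W c < 0)"
    by (meson absolutely_convergent_cycle_negative absolutely_convergent_edge_finite is_wdtmc_def)
next
  assume "(\<not> (\<exists>s s'. edge S P s s' \<and> reachable_from S P s_init [s, s'] \<and> W (s, s') = \<infinity>)) \<and>
    (\<forall>c. simple_cycle S P c \<and> reachable_from S P s_init c \<longrightarrow> path_weight W c < 0)"
  then show "absolutely_convergent S P W s_init"
    by (intro absolutely_convergentI[OF assms(2)]) blast+
qed

end
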